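(* There exists a universal constant $c>0$ such that for all $n$ and $k\in[n]$, $$\inf_{\widehat{\theta}}\sup_{\theta^*\in\Theta_{k}^{\uparrow}}\mathbb{E}\|\widehat{\theta}-\theta^*\|^2\geq \begin{cases} c\sigma^2, & k=1, \\ c\sigma^2k\log\log(16n/k), & k\geq 2, \end{cases}$$ where the infimum is over all measurable functions $\widehat\theta$ of $X$ and the expectation is under $X\sim N(\theta^*,\sigma^2 I_n)$.
   Context: $[n]=\{1,\dots,n\}$. For reals $a\le b$, $(a:b]$ is the set of integers $i$ with $a<i\le b$. For $k\in[n]$, $\Theta_k^{\uparrow}$ is the set of $\theta\in\mathbb{R}^n$ for which there exist integers $0=a_0\le a_1\le\cdots\le a_k=n$ and reals $\mu_1\le\cdots\le\mu_k$ with $\theta_i=\mu_j$ for all $i\in(a_{j-1}:a_j]$. *)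

theory Defs
  imports "HOL-Probability.Probability"
begin

text \<open>Vectors in R^n are represented as functions nat => real, extensional on {..<n};
  coordinate i (0-based) corresponds to the paper's coordinate i+1.\<close>

definition Theta_up :: "nat \<Rightarrow> nat \<Rightarrow> (nat \<Rightarrow> real) set" where
  "Theta_up n k = {\<theta>. \<theta> \<in> extensional {..<n} \<and>
     (\<exists>(a::nat \<Rightarrow> nat) (\<mu>::nat \<Rightarrow> real).
        a 0 = 0 \<and> a k = n \<and> (\<forall>j\<in>{1..k}. a (j - 1) \<le> a j) \<and>
        (\<forall>j\<in>{1..k}. \<forall>j'\<in>{1..k}. j \<le> j' \<longrightarrow> \<mu> j \<le> \<mu> j') \<and>
        (\<forall>j\<in>{1..k}. \<forall>i::nat. a (j - 1) < i \<and> i \<le> a j \<longrightarrow> \<theta> (i - 1) = \<mu> j))}"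

definition gauss_vec :: "nat \<Rightarrow> real \<Rightarrow> (nat \<Rightarrow> real) \<Rightarrow> (nat \<Rightarrow> real) measure" where
  "gauss_vec n \<sigma> \<theta> = PiM {..<n} (\<lambda>i. density lborel (normal_density (\<theta> i) \<sigma>))"

definition risk :: "nat \<Rightarrow> real \<Rightarrow> ((nat \<Rightarrow> real) \<Rightarrow> (nat \<Rightarrow> real)) \<Rightarrow> (nat \<Rightarrow> real) \<Rightarrow> ennreal" where
  "risk n \<sigma> est \<theta> = (\<integral>\<^sup>+ x. ennreal (\<Sum>i<n. (est x i - \<theta> i)\<^sup>2) \<partial>gauss_vec n \<sigma> \<theta>)"

end

theory Submission
  imports Defs "HOL-Library.Log_Nat"
begin

text \<open>
  Cut the coordinates into \<open>K = k div 2\<close> blocks of length \<open>m = n div K\<close>. On a block one may lower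
  the signal on the first \<open>2 ^ v\<close> coordinates by an amount whose squared norm is always
  \<open>\<sigma>\<^sup>2 ln M / 2\<close>, where \<open>v < M\<close> and \<open>M\<close> is about \<open>log m\<close>; different \<open>v\<close> are separated by a
  constant fraction of this norm. The \<open>M\<close> Gaussian laws cannot be told apart: their densities \<open>f\<^sub>v\<close>
  with respect to the law without perturbation have second moments at most \<open>\<surd>M\<close>, so by
  Cauchy-Schwarz \<open>\<integral> max f\<^sub>v \<le> \<surd>(M \<surd>M)\<close>, which is at most 7/8 of \<open>M = \<integral> \<Sum> f\<^sub>v\<close>.
  Hence every estimator pays a multiple of \<open>\<sigma>\<^sup>2 ln M\<close> on each block, on average over
  independent uniform choices of \<open>v\<close>, and \<open>ln M\<close> is of order \<open>log log (16 n / k)\<close>. Increasing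
  offsets between blocks keep the signal monotone. For \<open>k = 1\<close> the same bound is applied to two
  constant signals.
\<close>

section \<open>Multiple testing with bounded second moments\<close>

lemma (in prob_space) nn_integral_SUP_le_sqrt:
  fixes f :: "'v \<Rightarrow> 'a \<Rightarrow> ennreal" and E :: real
  assumes "finite V" and [measurable]: "\<And>v. v \<in> V \<Longrightarrow> f v \<in> borel_measurable M"
    and second_moment: "\<And>v. v \<in> V \<Longrightarrow> (\<integral>\<^sup>+x. (f v x)\<^sup>2 \<partial>M) \<le> ennreal E" and "E \<ge> 0"
  shows "(\<integral>\<^sup>+x. (SUP v\<in>V. f v x) \<partial>M) \<le> ennreal (sqrt (card V * E))"
proof -
  have "countable V" using \<open>finite V\<close> by (rule countable_finite)
  note [measurable] = borel_measurable_SUP[OF this]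
  have SUP_square_le: "(SUP v\<in>V. f v x)\<^sup>2 \<le> (\<Sum>v\<in>V. (f v x)\<^sup>2)" for x
  proof (cases "V = {}")
    case False
    then obtain u where "u \<in> V" "(SUP v\<in>V. f v x) = f u x"
      using \<open>finite V\<close> Max_in[of "(\<lambda>v. f v x) ` V"] by (auto simp: Max_Sup)
    thus ?thesis using member_le_sum[of u V "\<lambda>v. (f v x)\<^sup>2"] \<open>finite V\<close> by simp
  qed (simp add: bot_ennreal)
  have "(\<integral>\<^sup>+x. (SUP v\<in>V. f v x) \<partial>M)\<^sup>2 \<le> (\<integral>\<^sup>+x. (SUP v\<in>V. f v x)\<^sup>2 \<partial>M)"
    using Cauchy_Schwarz_nn_integral[of "\<lambda>x. SUP v\<in>V. f v x" M "\<lambda>_. 1"]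
    by (simp add: emeasure_space_1)
  also have "\<dots> \<le> (\<integral>\<^sup>+x. (\<Sum>v\<in>V. (f v x)\<^sup>2) \<partial>M)"
    by (intro nn_integral_mono SUP_square_le)
  also have "\<dots> = (\<Sum>v\<in>V. \<integral>\<^sup>+x. (f v x)\<^sup>2 \<partial>M)"
    by (intro nn_integral_sum) auto
  also have "\<dots> \<le> (\<Sum>v\<in>V. ennreal E)"
    by (intro sum_mono second_moment)
  also have "\<dots> = ennreal (card V * E)"
    by (simp add: ennreal_mult'' \<open>E \<ge> 0\<close> ennreal_of_nat_eq_real_of_nat)
  finally have square_le: "(\<integral>\<^sup>+x. (SUP v\<in>V. f v x) \<partial>M)\<^sup>2 \<le> ennreal (card V * E)" .
  show ?thesis
  proof (cases "\<integral>\<^sup>+x. (SUP v\<in>V. f v x) \<partial>M" rule: ennreal_cases)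
    case (real r)
    with square_le show ?thesis using \<open>E \<ge> 0\<close> by (simp add: ennreal_power real_le_rsqrt)
  next
    case top
    with square_le show ?thesis by (simp add: top_unique)
  qed
qed

lemma sum_weights_le_separated_loss_plus_SUP:
  fixes p w :: "'v \<Rightarrow> ennreal"
  assumes "finite V" and separated: "\<And>u v. u \<in> V \<Longrightarrow> v \<in> V \<Longrightarrow> u \<noteq> v \<Longrightarrow> \<delta> \<le> max (w u) (w v)"
  shows "(\<Sum>v\<in>V. \<delta> * p v) \<le> (\<Sum>v\<in>V. p v * w v) + \<delta> * (SUP v\<in>V. p v)"
proof (cases "\<forall>v\<in>V. \<delta> \<le> w v")
  case True
  hence "(\<Sum>v\<in>V. \<delta> * p v) \<le> (\<Sum>v\<in>V. p v * w v)"
    by (intro sum_mono) (simp add: mult.commute[of \<delta>] mult_left_mono)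
  thus ?thesis by (rule order_trans) simp
next
  case False
  then obtain u where u: "u \<in> V" "w u < \<delta>" by (auto simp: not_le)
  have others: "\<delta> \<le> w v" if "v \<in> V - {u}" for v
    using separated[of u v] u that by (auto simp: le_max_iff_disj)
  have "(\<Sum>v\<in>V. \<delta> * p v) = (\<Sum>v\<in>V-{u}. \<delta> * p v) + \<delta> * p u"
    using \<open>finite V\<close> u(1) by (simp add: sum.remove add.commute)
  also have "\<dots> \<le> (\<Sum>v\<in>V-{u}. p v * w v) + \<delta> * (SUP v\<in>V. p v)"
    using others u(1)
    by (intro add_mono sum_mono mult_left_mono SUP_upper)
      (simp_all add: mult.commute[of \<delta>] mult_left_mono)
  also have "\<dots> \<le> (\<Sum>v\<in>V. p v * w v) + \<delta> * (SUP v\<in>V. p v)"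
    using \<open>finite V\<close> by (intro add_right_mono sum_mono2) auto
  finally show ?thesis .
qed

lemma (in prob_space) multiple_testing_lower_bound:
  fixes f w :: "'v \<Rightarrow> 'a \<Rightarrow> ennreal" and E :: real
  assumes "finite V"
    and [measurable]: "\<And>v. v \<in> V \<Longrightarrow> f v \<in> borel_measurable M" "\<And>v. v \<in> V \<Longrightarrow> w v \<in> borel_measurable M"
    and density: "\<And>v. v \<in> V \<Longrightarrow> (\<integral>\<^sup>+x. f v x \<partial>M) = 1"
    and second_moment: "\<And>v. v \<in> V \<Longrightarrow> (\<integral>\<^sup>+x. (f v x)\<^sup>2 \<partial>M) \<le> ennreal E" and "E \<ge> 0"
    and separated: "\<And>u v x. u \<in> V \<Longrightarrow> v \<in> V \<Longrightarrow> u \<noteq> v \<Longrightarrow> \<delta> \<le> max (w u x) (w v x)"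
  shows "of_nat (card V) * \<delta>
    \<le> (\<Sum>v\<in>V. \<integral>\<^sup>+x. w v x \<partial>density M (f v)) + \<delta> * ennreal (sqrt (card V * E))"
proof -
  note [measurable] = borel_measurable_SUP[OF countable_finite[OF \<open>finite V\<close>]]
  have "of_nat (card V) * \<delta> = (\<Sum>v\<in>V. \<integral>\<^sup>+x. \<delta> * f v x \<partial>M)"
    by (simp add: nn_integral_cmult density)
  also have "\<dots> = (\<integral>\<^sup>+x. (\<Sum>v\<in>V. \<delta> * f v x) \<partial>M)"
    by (intro nn_integral_sum[symmetric]) auto
  also have "\<dots> \<le> (\<integral>\<^sup>+x. (\<Sum>v\<in>V. f v x * w v x) + \<delta> * (SUP v\<in>V. f v x) \<partial>M)"
    by (intro nn_integral_mono sum_weights_le_separated_loss_plus_SUP \<open>finite V\<close> separated)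
  also have "\<dots> = (\<Sum>v\<in>V. \<integral>\<^sup>+x. f v x * w v x \<partial>M) + \<delta> * (\<integral>\<^sup>+x. (SUP v\<in>V. f v x) \<partial>M)"
    by (simp add: nn_integral_add nn_integral_sum nn_integral_cmult)
  also have "\<dots> \<le> (\<Sum>v\<in>V. \<integral>\<^sup>+x. f v x * w v x \<partial>M) + \<delta> * ennreal (sqrt (card V * E))"
    using \<open>finite V\<close> second_moment \<open>E \<ge> 0\<close>
    by (intro add_left_mono mult_left_mono nn_integral_SUP_le_sqrt) auto
  also have "(\<Sum>v\<in>V. \<integral>\<^sup>+x. f v x * w v x \<partial>M) = (\<Sum>v\<in>V. \<integral>\<^sup>+x. w v x \<partial>density M (f v))"
    by (simp add: nn_integral_density)
  finally show ?thesis .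
qed

section \<open>Likelihood ratios of Gaussian vectors\<close>

lemma (in product_sigma_finite) PiM_density:
  assumes "finite I" and [measurable]: "\<And>i. i \<in> I \<Longrightarrow> f i \<in> borel_measurable (M i)"
    and "product_sigma_finite (\<lambda>i. density (M i) (f i))"
  shows "PiM I (\<lambda>i. density (M i) (f i)) = density (PiM I M) (\<lambda>x. \<Prod>i\<in>I. f i (x i))"
    (is "?N = density ?M ?f")
proof (rule product_sigma_finite.PiM_eqI[symmetric, OF assms(3) \<open>finite I\<close>])
  show "sets (density ?M ?f) = sets ?N"
    by (auto intro!: sets_PiM_cong)
next
  fix A assume "\<And>i. i \<in> I \<Longrightarrow> A i \<in> sets (density (M i) (f i))"
  hence A [measurable]: "\<And>i. i \<in> I \<Longrightarrow> A i \<in> sets (M i)" by simp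
  have indicator_PiE: "indicator (Pi\<^sub>E I A) x = (\<Prod>i\<in>I. indicator (A i) (x i) :: ennreal)"
    if "x \<in> space ?M" for x
    using that \<open>finite I\<close> by (auto simp: indicator_def space_PiM PiE_iff)
  have "emeasure (density ?M ?f) (Pi\<^sub>E I A) = (\<integral>\<^sup>+x. ?f x * indicator (Pi\<^sub>E I A) x \<partial>?M)"
    using A \<open>finite I\<close> by (intro emeasure_density sets_PiM_I_finite) auto
  also have "\<dots> = (\<integral>\<^sup>+x. (\<Prod>i\<in>I. f i (x i) * indicator (A i) (x i)) \<partial>?M)"
    by (intro nn_integral_cong) (simp add: indicator_PiE prod.distrib)
  also have "\<dots> = (\<Prod>i\<in>I. \<integral>\<^sup>+y. f i y * indicator (A i) y \<partial>M i)"
    by (intro product_nn_integral_prod \<open>finite I\<close>) auto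
  also have "\<dots> = (\<Prod>i\<in>I. emeasure (density (M i) (f i)) (A i))"
    by (intro prod.cong) (auto simp: emeasure_density)
  finally show "emeasure (density ?M ?f) (Pi\<^sub>E I A)
      = (\<Prod>i\<in>I. emeasure (density (M i) (f i)) (A i))" .
qed

definition likelihood_ratio ::
  "nat \<Rightarrow> real \<Rightarrow> (nat \<Rightarrow> real) \<Rightarrow> (nat \<Rightarrow> real) \<Rightarrow> (nat \<Rightarrow> real) \<Rightarrow> real" where
  "likelihood_ratio n \<sigma> \<theta> \<eta> x = exp (\<Sum>i<n. ((x i - \<eta> i)\<^sup>2 - (x i - \<theta> i)\<^sup>2) / (2 * \<sigma>\<^sup>2))"

lemma sets_gauss_vec [measurable_cong, simp]:
  "sets (gauss_vec n \<sigma> \<theta>) = sets (PiM {..<n} (\<lambda>_. lborel))"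
  unfolding gauss_vec_def by (auto intro!: sets_PiM_cong)

lemma prob_space_gauss_vec: "\<sigma> > 0 \<Longrightarrow> prob_space (gauss_vec n \<sigma> \<theta>)"
  unfolding gauss_vec_def by (intro prob_space_PiM prob_space_normal_density)

lemma borel_measurable_likelihood_ratio [measurable]:
  "likelihood_ratio n \<sigma> \<theta> \<eta> \<in> borel_measurable (PiM {..<n} (\<lambda>_. lborel))"
  unfolding likelihood_ratio_def by measurable

lemma likelihood_ratio_nonneg [simp]: "likelihood_ratio n \<sigma> \<theta> \<eta> x \<ge> 0"
  by (simp add: likelihood_ratio_def)

lemma normal_density_eq_mult_exp:
  "normal_density a \<sigma> y = normal_density b \<sigma> y * exp (((y - b)\<^sup>2 - (y - a)\<^sup>2) / (2 * \<sigma>\<^sup>2))"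
  unfolding normal_density_def by (simp add: exp_add[symmetric] diff_divide_distrib)

lemma gauss_vec_eq_density_likelihood_ratio:
  assumes "\<sigma> > 0"
  shows "gauss_vec n \<sigma> \<theta> = density (gauss_vec n \<sigma> \<eta>) (\<lambda>x. ennreal (likelihood_ratio n \<sigma> \<theta> \<eta> x))"
proof -
  let ?N = "\<lambda>\<mu> i. density lborel (normal_density (\<mu> i) \<sigma>)"
  let ?r = "\<lambda>i y. exp (((y - \<eta> i)\<^sup>2 - (y - \<theta> i)\<^sup>2) / (2 * \<sigma>\<^sup>2))"
  have sigma_finite: "product_sigma_finite (?N \<mu>)" for \<mu> :: "nat \<Rightarrow> real"
    using prob_space_normal_density[OF assms]
    by (simp add: product_sigma_finite_def prob_space_imp_sigma_finite)
  have coordinate: "?N \<theta> i = density (?N \<eta> i) (\<lambda>y. ennreal (?r i y))" for i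
    using normal_density_eq_mult_exp[of "\<theta> i" \<sigma> _ "\<eta> i"]
    by (simp add: density_density_eq ennreal_mult'')
  have "gauss_vec n \<sigma> \<theta> = PiM {..<n} (\<lambda>i. density (?N \<eta> i) (\<lambda>y. ennreal (?r i y)))"
    by (simp only: gauss_vec_def coordinate)
  also have "\<dots> = density (gauss_vec n \<sigma> \<eta>) (\<lambda>x. \<Prod>i<n. ennreal (?r i (x i)))"
    unfolding gauss_vec_def
    using sigma_finite[of \<theta>]
    by (intro product_sigma_finite.PiM_density[OF sigma_finite]) (simp_all add: coordinate)
  finally show ?thesis
    by (simp add: likelihood_ratio_def exp_sum prod_ennreal)
qed

lemma likelihood_ratio_square:
  "(likelihood_ratio n \<sigma> \<theta> \<eta> x)\<^sup>2
    = exp ((\<Sum>i<n. (\<theta> i - \<eta> i)\<^sup>2) / \<sigma>\<^sup>2) * likelihood_ratio n \<sigma> (\<lambda>i. 2 * \<theta> i - \<eta> i) \<eta> x"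
proof -
  have "2 * (((y - b)\<^sup>2 - (y - a)\<^sup>2) / (2 * \<sigma>\<^sup>2))
      = (a - b)\<^sup>2 / \<sigma>\<^sup>2 + ((y - b)\<^sup>2 - (y - (2 * a - b))\<^sup>2) / (2 * \<sigma>\<^sup>2)" for a b y :: real
    by (cases "\<sigma> = 0") (simp_all add: field_simps power2_eq_square)
  thus ?thesis
    by (simp only: likelihood_ratio_def exp_double[symmetric] exp_add[symmetric] sum_distrib_left
        sum.distrib sum_divide_distrib)
qed

lemma nn_integral_likelihood_ratio:
  assumes "\<sigma> > 0"
  shows "(\<integral>\<^sup>+x. ennreal (likelihood_ratio n \<sigma> \<theta> \<eta> x) \<partial>gauss_vec n \<sigma> \<eta>) = 1"
proof -
  have "(\<integral>\<^sup>+x. ennreal (likelihood_ratio n \<sigma> \<theta> \<eta> x) \<partial>gauss_vec n \<sigma> \<eta>)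
      = emeasure (gauss_vec n \<sigma> \<theta>) (space (gauss_vec n \<sigma> \<eta>))"
    unfolding gauss_vec_eq_density_likelihood_ratio[OF assms, of n \<theta> \<eta>]
    by (subst emeasure_density[OF _ sets.top]) (auto cong: nn_integral_cong)
  also have "space (gauss_vec n \<sigma> \<eta>) = space (gauss_vec n \<sigma> \<theta>)"
    by (intro sets_eq_imp_space_eq) simp
  finally show ?thesis
    by (simp add: prob_space.emeasure_space_1[OF prob_space_gauss_vec[OF assms]])
qed

lemma nn_integral_likelihood_ratio_square:
  assumes "\<sigma> > 0"
  shows "(\<integral>\<^sup>+x. (ennreal (likelihood_ratio n \<sigma> \<theta> \<eta> x))\<^sup>2 \<partial>gauss_vec n \<sigma> \<eta>)
    = ennreal (exp ((\<Sum>i<n. (\<theta> i - \<eta> i)\<^sup>2) / \<sigma>\<^sup>2))"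
  by (simp add: ennreal_power likelihood_ratio_square ennreal_mult nn_integral_cmult
      nn_integral_likelihood_ratio[OF assms])

lemma second_moment_likelihood_ratio_le:
  assumes "\<sigma> > 0" "M > 0" and close: "(\<Sum>i<n. (\<theta> i - \<eta> i)\<^sup>2) \<le> \<sigma>\<^sup>2 * ln M / 2"
  shows "(\<integral>\<^sup>+x. (ennreal (likelihood_ratio n \<sigma> \<theta> \<eta> x))\<^sup>2 \<partial>gauss_vec n \<sigma> \<eta>) \<le> ennreal (sqrt M)"
proof -
  have "(\<Sum>i<n. (\<theta> i - \<eta> i)\<^sup>2) / \<sigma>\<^sup>2 \<le> ln M / 2"
    using close \<open>\<sigma> > 0\<close> by (simp add: pos_divide_le_eq mult.commute)
  also have "\<dots> = ln (sqrt M)" using \<open>M > 0\<close> by (simp add: ln_sqrt)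
  finally show ?thesis
    using \<open>M > 0\<close>
    by (simp add: nn_integral_likelihood_ratio_square[OF \<open>\<sigma> > 0\<close>] ln_ge_iff ennreal_leI)
qed

section \<open>Averaging over hypercubes\<close>

lemma sum_PiE_remove:
  assumes "j \<in> A"
  shows "(\<Sum>f\<in>Pi\<^sub>E A B. F f) = (\<Sum>g\<in>Pi\<^sub>E (A - {j}) B. \<Sum>v\<in>B j. F (g(j := v)))"
proof -
  have "Pi\<^sub>E A B = (\<lambda>(y, g). g(j := y)) ` (B j \<times> Pi\<^sub>E (A - {j}) B)"
    using PiE_insert_eq[of j "A - {j}" B] assms by (simp add: insert_absorb)
  moreover have "inj_on (\<lambda>(y, g). g(j := y)) (B j \<times> Pi\<^sub>E (A - {j}) B)"
    by (rule inj_combinator) simp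
  ultimately have "(\<Sum>f\<in>Pi\<^sub>E A B. F f) = (\<Sum>(v, g)\<in>B j \<times> Pi\<^sub>E (A - {j}) B. F (g(j := v)))"
    by (simp add: sum.reindex case_prod_unfold)
  also have "\<dots> = (\<Sum>v\<in>B j. \<Sum>g\<in>Pi\<^sub>E (A - {j}) B. F (g(j := v)))"
    by (rule sum.cartesian_product[symmetric])
  finally show ?thesis by (simp add: sum.swap[of _ "B j"])
qed

lemma card_PiE_mult_le_sum:
  fixes F :: "('j \<Rightarrow> 'v) \<Rightarrow> ennreal"
  assumes "finite J" "j \<in> J"
    and fibre: "\<And>g. g \<in> Pi\<^sub>E (J - {j}) B \<Longrightarrow> of_nat (card (B j)) * c \<le> (\<Sum>v\<in>B j. F (g(j := v)))"
  shows "of_nat (card (Pi\<^sub>E J B)) * c \<le> (\<Sum>l\<in>Pi\<^sub>E J B. F l)"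
proof -
  have "card (Pi\<^sub>E J B) = card (Pi\<^sub>E (J - {j}) B) * card (B j)"
    using assms(1,2) by (simp add: card_PiE prod.remove mult.commute)
  hence "of_nat (card (Pi\<^sub>E J B)) * c = (\<Sum>g\<in>Pi\<^sub>E (J - {j}) B. of_nat (card (B j)) * c)"
    by (simp add: mult.assoc)
  also have "\<dots> \<le> (\<Sum>l\<in>Pi\<^sub>E J B. F l)"
    unfolding sum_PiE_remove[OF \<open>j \<in> J\<close>] by (intro sum_mono fibre)
  finally show ?thesis .
qed

lemma le_SUP_if_card_mult_le_sum:
  fixes f :: "'a \<Rightarrow> ennreal"
  assumes "finite A" "A \<noteq> {}" "of_nat (card A) * c \<le> (\<Sum>a\<in>A. f a)"
  shows "c \<le> (SUP a\<in>A. f a)"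
proof -
  have "of_nat (card A) * c \<le> (\<Sum>a\<in>A. SUP a\<in>A. f a)"
    using assms(3) by (rule order_trans) (intro sum_mono SUP_upper)
  thus ?thesis
    using assms(1,2) by (simp add: ennreal_mult_le_mult_iff)
qed

lemma card_mult_le_SUP_sum_PiE:
  fixes R :: "'j \<Rightarrow> ('j \<Rightarrow> 'v) \<Rightarrow> ennreal"
  assumes "finite J" "\<And>j. j \<in> J \<Longrightarrow> finite (B j)" "\<And>j. j \<in> J \<Longrightarrow> B j \<noteq> {}"
    and fibre: "\<And>j g. j \<in> J \<Longrightarrow> g \<in> Pi\<^sub>E (J - {j}) B \<Longrightarrow>
      of_nat (card (B j)) * c \<le> (\<Sum>v\<in>B j. R j (g(j := v)))"
  shows "of_nat (card J) * c \<le> (SUP l\<in>Pi\<^sub>E J B. \<Sum>j\<in>J. R j l)"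
proof (rule le_SUP_if_card_mult_le_sum)
  have "of_nat (card (Pi\<^sub>E J B)) * (of_nat (card J) * c) = (\<Sum>j\<in>J. of_nat (card (Pi\<^sub>E J B)) * c)"
    by (simp add: mult_ac)
  also have "\<dots> \<le> (\<Sum>j\<in>J. \<Sum>l\<in>Pi\<^sub>E J B. R j l)"
    using assms(1) fibre by (intro sum_mono card_PiE_mult_le_sum)
  also have "\<dots> = (\<Sum>l\<in>Pi\<^sub>E J B. \<Sum>j\<in>J. R j l)"
    by (rule sum.swap)
  finally show "of_nat (card (Pi\<^sub>E J B)) * (of_nat (card J) * c) \<le> (\<Sum>l\<in>Pi\<^sub>E J B. \<Sum>j\<in>J. R j l)" .
qed (use assms(1-3) in \<open>simp_all add: finite_PiE PiE_eq_empty_iff\<close>)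

section \<open>Risk of an estimator over a hypercube of signals\<close>

lemma half_square_dist_le_sum_squares: "(a - b)\<^sup>2 / 2 \<le> (e - a)\<^sup>2 + (e - b)\<^sup>2" for a b e :: real
proof -
  have "(e - a)\<^sup>2 + (e - b)\<^sup>2 - (a - b)\<^sup>2 / 2 = 2 * (e - (a + b) / 2)\<^sup>2"
    by (simp add: power2_eq_square field_simps)
  also have "\<dots> \<ge> 0" by simp
  finally show ?thesis by simp
qed

lemma sqrt_mult_sqrt_le:
  fixes M :: real
  assumes "M \<ge> 2"
  shows "sqrt (M * sqrt M) \<le> 7 / 8 * M"
proof -
  have "64 / 49 \<le> sqrt M"
    using assms by (intro real_le_rsqrt) (simp add: power2_eq_square)
  hence "M * sqrt M * (64 / 49) \<le> M * sqrt M * sqrt M"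
    using assms by (intro mult_left_mono) auto
  also have "\<dots> = M\<^sup>2" using assms by (simp add: power2_eq_square)
  finally show ?thesis
    using assms by (intro real_le_lsqrt) (simp_all add: power_mult_distrib power2_eq_square)
qed

locale gaussian_estimation =
  fixes n :: nat and \<sigma> :: real and est :: "(nat \<Rightarrow> real) \<Rightarrow> nat \<Rightarrow> real"
  assumes sigma_pos: "\<sigma> > 0"
    and est_measurable: "\<And>i. i < n \<Longrightarrow> (\<lambda>x. est x i) \<in> borel_measurable (PiM {..<n} (\<lambda>_. lborel))"
begin

definition partial_risk :: "nat set \<Rightarrow> (nat \<Rightarrow> real) \<Rightarrow> ennreal" where
  "partial_risk I \<theta> = (\<integral>\<^sup>+x. ennreal (\<Sum>i\<in>I. (est x i - \<theta> i)\<^sup>2) \<partial>gauss_vec n \<sigma> \<theta>)"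

lemma borel_measurable_loss [measurable]:
  assumes "I \<subseteq> {..<n}"
  shows "(\<lambda>x. \<Sum>i\<in>I. (est x i - \<theta> i)\<^sup>2) \<in> borel_measurable (PiM {..<n} (\<lambda>_. lborel))"
  using assms
  by (intro borel_measurable_sum borel_measurable_power borel_measurable_diff est_measurable) auto

lemma sum_partial_risk_le_risk:
  assumes "finite J" "disjoint_family_on I J" "\<And>j. j \<in> J \<Longrightarrow> I j \<subseteq> {..<n}"
  shows "(\<Sum>j\<in>J. partial_risk (I j) \<theta>) \<le> risk n \<sigma> est \<theta>"
proof -
  let ?loss = "\<lambda>I x. \<Sum>i\<in>I. (est x i - \<theta> i)\<^sup>2"
  have "(\<Sum>j\<in>J. partial_risk (I j) \<theta>) = (\<integral>\<^sup>+x. (\<Sum>j\<in>J. ennreal (?loss (I j) x)) \<partial>gauss_vec n \<sigma> \<theta>)"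
    unfolding partial_risk_def using assms(3) by (intro nn_integral_sum[symmetric]) measurable
  also have "\<dots> \<le> risk n \<sigma> est \<theta>"
    unfolding risk_def
  proof (rule nn_integral_mono)
    fix x
    have "(\<Sum>j\<in>J. ennreal (?loss (I j) x)) = ennreal (?loss (\<Union>j\<in>J. I j) x)"
      using assms by (subst sum.UNION_disjoint_family)
        (auto intro: finite_subset intro!: sum_ennreal sum_nonneg)
    also have "\<dots> \<le> ennreal (?loss {..<n} x)"
      using assms(3) by (intro ennreal_leI sum_mono2) auto
    finally show "(\<Sum>j\<in>J. ennreal (?loss (I j) x)) \<le> ennreal (?loss {..<n} x)" .
  qed
  finally show ?thesis .
qed

text \<open>The losses are \<open>D / 4\<close>-separated, and tests err with average probability at least \<open>1 - 7 / 8\<close>.\<close>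

lemma sum_partial_risk_ge:
  assumes V: "finite V" "card V \<ge> 2" and I: "I \<subseteq> {..<n}" and "D \<ge> 0"
    and close: "\<And>v. v \<in> V \<Longrightarrow> (\<Sum>i<n. (\<theta> v i - \<eta> i)\<^sup>2) \<le> \<sigma>\<^sup>2 * ln (card V) / 2"
    and separated: "\<And>u v. u \<in> V \<Longrightarrow> v \<in> V \<Longrightarrow> u \<noteq> v \<Longrightarrow> D \<le> (\<Sum>i\<in>I. (\<theta> u i - \<theta> v i)\<^sup>2)"
  shows "of_nat (card V) * ennreal (D / 32) \<le> (\<Sum>v\<in>V. partial_risk I (\<theta> v))"
proof -
  interpret prob_space "gauss_vec n \<sigma> \<eta>" by (rule prob_space_gauss_vec[OF sigma_pos])
  let ?M = "real (card V)"
  let ?ratio = "\<lambda>v x. ennreal (likelihood_ratio n \<sigma> (\<theta> v) \<eta> x)"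
  let ?loss = "\<lambda>v x. \<Sum>i\<in>I. (est x i - \<theta> v i)\<^sup>2"
  have M: "?M \<ge> 2" using V(2) by simp
  have loss_separated: "ennreal (D / 4) \<le> max (ennreal (?loss u x)) (ennreal (?loss v x))"
    if "u \<in> V" "v \<in> V" "u \<noteq> v" for u v x
  proof -
    have "D / 2 \<le> (\<Sum>i\<in>I. (\<theta> u i - \<theta> v i)\<^sup>2 / 2)"
      using separated[OF that] by (simp add: sum_divide_distrib[symmetric])
    also have "\<dots> \<le> ?loss u x + ?loss v x"
      unfolding sum.distrib[symmetric] by (intro sum_mono half_square_dist_le_sum_squares)
    finally have "D / 4 \<le> max (?loss u x) (?loss v x)" by simp
    thus ?thesis by (auto simp: le_max_iff_disj intro: ennreal_leI)
  qed
  have second_moment: "(\<integral>\<^sup>+x. (?ratio v x)\<^sup>2 \<partial>gauss_vec n \<sigma> \<eta>) \<le> ennreal (sqrt ?M)" if "v \<in> V" for v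
    using M by (intro second_moment_likelihood_ratio_le sigma_pos close that) auto
  have "of_nat (card V) * ennreal (D / 4)
      \<le> (\<Sum>v\<in>V. \<integral>\<^sup>+x. ennreal (?loss v x) \<partial>density (gauss_vec n \<sigma> \<eta>) (?ratio v))
        + ennreal (D / 4) * ennreal (sqrt (?M * sqrt ?M))"
    using V(1) I second_moment loss_separated
    by (intro multiple_testing_lower_bound) (auto simp: nn_integral_likelihood_ratio[OF sigma_pos])
  also have "\<dots> = (\<Sum>v\<in>V. partial_risk I (\<theta> v)) + ennreal (D / 4) * ennreal (sqrt (?M * sqrt ?M))"
    by (simp add: partial_risk_def
        gauss_vec_eq_density_likelihood_ratio[OF sigma_pos, of n _ \<eta>, symmetric])
  also have "\<dots> \<le> (\<Sum>v\<in>V. partial_risk I (\<theta> v)) + ennreal (D / 4) * ennreal (7 / 8 * ?M)"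
    using M by (intro add_left_mono mult_left_mono ennreal_leI sqrt_mult_sqrt_le) auto
  also have "of_nat (card V) * ennreal (D / 4)
      = of_nat (card V) * ennreal (D / 32) + ennreal (D / 4) * ennreal (7 / 8 * ?M)"
    using \<open>D \<ge> 0\<close> by (simp add: ennreal_of_nat_eq_real_of_nat ennreal_mult''[symmetric]
        ennreal_plus[symmetric] del: ennreal_plus)
  finally show ?thesis
    by (simp add: add.commute[of _ "ennreal (D / 4) * _"] ennreal_add_left_cancel_le
        ennreal_mult_eq_top_iff)
qed

text \<open>Assouad's argument: the supremum is at least the average over independent uniform choices, in
  which every \<open>j\<close> contributes the testing bound conditionally on the choices at the other indices.\<close>

lemma SUP_risk_ge_hypercube:
  fixes \<theta> :: "('j \<Rightarrow> 'v) \<Rightarrow> nat \<Rightarrow> real"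
  assumes J: "finite J" "disjoint_family_on I J" "\<And>j. j \<in> J \<Longrightarrow> I j \<subseteq> {..<n}"
    and V: "finite V" "card V \<ge> 2" and "D \<ge> 0"
    and in_\<Theta>: "\<And>l. l \<in> J \<rightarrow>\<^sub>E V \<Longrightarrow> \<theta> l \<in> \<Theta>"
    and close: "\<And>j g v. j \<in> J \<Longrightarrow> v \<in> V \<Longrightarrow>
      (\<Sum>i<n. (\<theta> (g(j := v)) i - \<eta> j g i)\<^sup>2) \<le> \<sigma>\<^sup>2 * ln (card V) / 2"
    and separated: "\<And>j g u v. j \<in> J \<Longrightarrow> u \<in> V \<Longrightarrow> v \<in> V \<Longrightarrow> u \<noteq> v \<Longrightarrow>
      D \<le> (\<Sum>i\<in>I j. (\<theta> (g(j := u)) i - \<theta> (g(j := v)) i)\<^sup>2)"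
  shows "of_nat (card J) * ennreal (D / 32) \<le> (SUP \<theta>\<in>\<Theta>. risk n \<sigma> est \<theta>)"
proof -
  have "of_nat (card J) * ennreal (D / 32) \<le> (SUP l\<in>J \<rightarrow>\<^sub>E V. \<Sum>j\<in>J. partial_risk (I j) (\<theta> l))"
  proof (rule card_mult_le_SUP_sum_PiE[OF J(1)])
    fix j g assume "j \<in> J"
    thus "of_nat (card V) * ennreal (D / 32) \<le> (\<Sum>v\<in>V. partial_risk (I j) (\<theta> (g(j := v))))"
      by (intro sum_partial_risk_ge[where \<eta> = "\<eta> j g"] V J(3) \<open>D \<ge> 0\<close> close separated)
  qed (use V in auto)
  also have "\<dots> \<le> (SUP l\<in>J \<rightarrow>\<^sub>E V. risk n \<sigma> est (\<theta> l))"
    by (intro SUP_mono' sum_partial_risk_le_risk J)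
  also have "\<dots> \<le> (SUP \<theta>\<in>\<Theta>. risk n \<sigma> est \<theta>)"
    by (intro SUP_least SUP_upper in_\<Theta>)
  finally show ?thesis .
qed

end

section \<open>Monotone step vectors\<close>

lemma downward_closed_eq_lessThan_card:
  fixes A :: "nat set"
  assumes "finite A" and down: "\<And>i j. j \<in> A \<Longrightarrow> i \<le> j \<Longrightarrow> i \<in> A"
  shows "A = {..<card A}"
proof (intro equalityI subsetI)
  fix i assume "i \<in> A"
  hence "card {..i} \<le> card A" using assms by (intro card_mono) auto
  thus "i \<in> {..<card A}" by simp
next
  fix i assume "i \<in> {..<card A}"
  hence "\<not> A \<subseteq> {..<i}" using card_mono[of "{..<i}" A] by auto
  thus "i \<in> A" using down by (meson lessThan_iff not_le subsetI)
qed

text \<open>The \<open>j\<close>-th piece consists of the indices of rank \<open>j - 1\<close> and may be empty for large \<open>j\<close>.\<close>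

lemma Theta_upI_rank:
  fixes rank :: "nat \<Rightarrow> nat"
  assumes "\<theta> \<in> extensional {..<n}" and mono: "mono_on {..<n} \<theta>" and "n > 0"
    and rank_le_iff: "\<And>i i'. i < n \<Longrightarrow> i' < n \<Longrightarrow> rank i \<le> rank i' \<longleftrightarrow> \<theta> i \<le> \<theta> i'"
    and "rank 0 = 0" and rank_less: "\<And>i. i < n \<Longrightarrow> rank i < k"
  shows "\<theta> \<in> Theta_up n k"
proof -
  define a where "a j = card {i. i < n \<and> rank i < j}" for j
  have rank_mono: "rank i \<le> rank i'" if "i \<le> i'" "i' < n" for i i'
    using mono_onD[OF mono, of i i'] rank_le_iff[of i i'] that by simp
  have less_a_iff: "i < a j \<longleftrightarrow> i < n \<and> rank i < j" for i j
  proof -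
    have "{i. i < n \<and> rank i < j} = {..<a j}"
      unfolding a_def
      by (rule downward_closed_eq_lessThan_card) (auto intro: le_less_trans rank_mono)
    thus ?thesis by auto
  qed
  have a_mono: "a j \<le> a j'" if "j \<le> j'" for j j'
    unfolding a_def using that by (intro card_mono) auto
  have last_less: "a j - 1 < a j" if "j \<ge> 1" for j
    using that less_a_iff[of 0 j] \<open>n > 0\<close> \<open>rank 0 = 0\<close> by simp
  show ?thesis
    unfolding Theta_up_def
  proof (intro CollectI conjI exI[of _ a] exI[of _ "\<lambda>j. \<theta> (a j - 1)"] ballI allI impI)
    show "a 0 = 0" by (simp add: a_def)
    have "{i. i < n \<and> rank i < k} = {..<n}" using rank_less by auto
    thus "a k = n" by (simp add: a_def)
    fix j assume "j \<in> {1..k}"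
    hence j: "j \<ge> 1" by simp
    show "a (j - 1) \<le> a j" by (rule a_mono) simp
    show "\<theta> (a j - 1) \<le> \<theta> (a j' - 1)" if "j' \<in> {1..k}" "j \<le> j'" for j'
      using that j a_mono[OF that(2)] last_less[of j] last_less[of j'] less_a_iff
      by (intro mono_onD[OF mono]) auto
    fix i assume i: "a (j - 1) < i \<and> i \<le> a j"
    let ?i = "i - 1" and ?l = "a j - 1"
    have order: "?i \<le> ?l" "?l < n" using i last_less[OF j] less_a_iff[of ?l j] by auto
    have "rank ?l < j" "\<not> rank ?i < j - 1"
      using last_less[OF j] less_a_iff[of ?l j] less_a_iff[of ?i "j - 1"] i order by auto
    hence "rank ?l \<le> rank ?i" by simp
    thus "\<theta> ?i = \<theta> ?l" using mono_onD[OF mono, of ?i ?l] rank_le_iff[of ?l ?i] order by simp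
  qed (rule assms(1))
qed

lemma mono_on_in_Theta_up:
  assumes "\<theta> \<in> extensional {..<n}" and mono: "mono_on {..<n} \<theta>" and "n > 0"
    and card: "card (\<theta> ` {..<n}) \<le> k"
  shows "\<theta> \<in> Theta_up n k"
proof -
  define rank where "rank i = card {s \<in> \<theta> ` {..<n}. s < \<theta> i}" for i
  show ?thesis
  proof (rule Theta_upI_rank[OF assms(1) mono \<open>n > 0\<close>])
    fix i i' assume i: "i < n" "i' < n"
    have "rank i \<le> rank i'" if "\<theta> i \<le> \<theta> i'"
      unfolding rank_def using that by (intro card_mono) auto
    moreover have "rank i' < rank i" if "\<theta> i' < \<theta> i"
      unfolding rank_def using i that by (intro psubset_card_mono) (auto simp: psubset_eq)
    ultimately show "rank i \<le> rank i' \<longleftrightarrow> \<theta> i \<le> \<theta> i'" by (meson not_le)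
  next
    show "rank 0 = 0"
      using mono_onD[OF mono, of 0] \<open>n > 0\<close> by (auto simp: rank_def not_less[symmetric])
  next
    fix i assume "i < n"
    hence "rank i < card (\<theta> ` {..<n})"
      unfolding rank_def by (intro psubset_card_mono) auto
    thus "rank i < k" using card by simp
  qed
qed

text \<open>The last of the \<open>K\<close> blocks absorbs the remainder of \<open>{..<n}\<close>.\<close>

definition block :: "nat \<Rightarrow> nat \<Rightarrow> nat \<Rightarrow> nat" where
  "block m K i = min (i div m) (K - 1)"

definition staircase :: "nat \<Rightarrow> nat \<Rightarrow> nat \<Rightarrow> real \<Rightarrow> (nat \<Rightarrow> nat \<Rightarrow> real) \<Rightarrow> nat \<Rightarrow> real" where
  "staircase n m K \<beta> d =
    (\<lambda>i\<in>{..<n}. real (block m K i) * \<beta> - d (block m K i) (i - block m K i * m))"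

lemma block_mono: "i \<le> i' \<Longrightarrow> block m K i \<le> block m K i'"
  unfolding block_def by (intro min.mono div_le_mono) auto

lemma block_times_le: "block m K i * m \<le> i"
  by (metis block_def min.cobounded1 mult_le_mono1 div_times_less_eq_dividend order_trans)

lemma block_eqI:
  assumes "b < K" "b * m \<le> i" "i < b * m + m"
  shows "block m K i = b"
proof -
  have "i div m = b" using assms(2,3) by (intro div_nat_eqI) (auto simp: mult.commute)
  thus ?thesis using assms(1) by (simp add: block_def)
qed

lemma disjoint_family_blocks: "disjoint_family_on (\<lambda>j::nat. {j * m..<j * m + m}) J"
proof -
  have "i div m = j" if "i \<in> {j * m..<j * m + m}" for i j
    using that by (intro div_nat_eqI) (auto simp: mult.commute)
  hence "j = j'" if "i \<in> {j * m..<j * m + m}" "i \<in> {j' * m..<j' * m + m}" for i j j'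
    using that by metis
  thus ?thesis unfolding disjoint_family_on_def by blast
qed

lemma block_end_le:
  fixes j K m n :: nat
  assumes "j < K" "K * m \<le> n"
  shows "j * m + m \<le> n"
  using mult_le_mono1[of "Suc j" K m] assms by auto

lemma mono_on_staircase:
  assumes antimono: "\<And>b. antimono (d b)" and bounds: "\<And>b r. 0 \<le> d b r" "\<And>b r. d b r \<le> \<beta>"
  shows "mono_on {..<n} (staircase n m K \<beta> d)"
proof (rule mono_onI)
  fix i i' assume i: "i \<in> {..<n}" "i' \<in> {..<n}" "i \<le> i'"
  let ?b = "block m K i" and ?b' = "block m K i'"
  have "real ?b * \<beta> - d ?b (i - ?b * m) \<le> real ?b' * \<beta> - d ?b' (i' - ?b' * m)"
  proof (cases "?b = ?b'")
    case True
    thus ?thesis using antimonoD[OF antimono, of "i - ?b' * m" "i' - ?b' * m"] i(3) by simp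
  next
    case False
    hence "real ?b + 1 \<le> real ?b'" using block_mono[OF i(3), of m K] by simp
    moreover have "0 \<le> \<beta>" using bounds[of 0 0] by linarith
    ultimately have "(real ?b + 1) * \<beta> \<le> real ?b' * \<beta>" by (rule mult_right_mono)
    moreover have "0 \<le> d ?b (i - ?b * m)" "d ?b' (i' - ?b' * m) \<le> \<beta>" by (rule bounds)+
    ultimately show ?thesis by (simp add: algebra_simps)
  qed
  thus "staircase n m K \<beta> d i \<le> staircase n m K \<beta> d i'" using i by (simp add: staircase_def)
qed

lemma card_staircase_image_le:
  assumes "K > 0" and "\<And>b. finite (range (d b))" and "\<And>b. card (range (d b)) \<le> c"
  shows "card (staircase n m K \<beta> d ` {..<n}) \<le> c * K"
proof -
  let ?values = "\<lambda>b. (\<lambda>y. real b * \<beta> - y) ` range (d b)"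
  have "block m K i < K" for i using \<open>K > 0\<close> by (simp add: block_def)
  hence "staircase n m K \<beta> d ` {..<n} \<subseteq> (\<Union>b<K. ?values b)"
    by (force simp: staircase_def)
  hence "card (staircase n m K \<beta> d ` {..<n}) \<le> card (\<Union>b<K. ?values b)"
    using assms(2) by (intro card_mono) auto
  also have "\<dots> \<le> (\<Sum>b<K. card (?values b))" by (rule card_UN_le) simp
  also have "\<dots> \<le> (\<Sum>b<K. c)"
    using assms(2,3) by (intro sum_mono) (meson card_image_le order_trans)
  finally show ?thesis by (simp add: mult.commute)
qed

lemma sum_block_staircase_upd_dist:
  assumes "j < K" "K * m \<le> n"
  shows "(\<Sum>i\<in>{j * m..<j * m + m}.
      (staircase n m K \<beta> (d(j := p)) i - staircase n m K \<beta> (d(j := q)) i)\<^sup>2) = (\<Sum>r<m. (p r - q r)\<^sup>2)"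
proof -
  let ?dist = "\<lambda>i. (staircase n m K \<beta> (d(j := p)) i - staircase n m K \<beta> (d(j := q)) i)\<^sup>2"
  have "?dist (j * m + r) = (p r - q r)\<^sup>2" if "r < m" for r
  proof -
    have "block m K (j * m + r) = j" using assms(1) that by (intro block_eqI) auto
    moreover have "j * m + r < n" using block_end_le[OF assms] that by simp
    ultimately show ?thesis by (simp add: staircase_def power2_commute)
  qed
  moreover have "sum ?dist {j * m..<j * m + m} = (\<Sum>r<m. ?dist (j * m + r))"
    using sum.shift_bounds_nat_ivl[of ?dist 0 "j * m" m]
    by (simp add: add.commute lessThan_atLeast0)
  ultimately show ?thesis by simp
qed

lemma sum_staircase_upd_dist:
  assumes j: "j < K" "K * m \<le> n" and tail: "\<And>r. m \<le> r \<Longrightarrow> p r = q r"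
  shows "(\<Sum>i<n. (staircase n m K \<beta> (d(j := p)) i - staircase n m K \<beta> (d(j := q)) i)\<^sup>2)
    = (\<Sum>r<m. (p r - q r)\<^sup>2)"
proof -
  let ?dist = "\<lambda>i. (staircase n m K \<beta> (d(j := p)) i - staircase n m K \<beta> (d(j := q)) i)\<^sup>2"
  have "?dist i = 0" if "i \<in> {..<n} - {j * m..<j * m + m}" for i
    using that block_times_le[of m K i] tail[of "i - j * m"] by (auto simp: staircase_def)
  hence "sum ?dist {..<n} = sum ?dist {j * m..<j * m + m}"
    using block_end_le[OF j] by (intro sum.mono_neutral_right) auto
  thus ?thesis by (simp add: sum_block_staircase_upd_dist[OF j])
qed

definition dip :: "real \<Rightarrow> nat \<Rightarrow> nat \<Rightarrow> real" where
  "dip H v r = (if r < 2 ^ v then sqrt (H / 2 ^ v) else 0)"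

lemma antimono_dip: "H \<ge> 0 \<Longrightarrow> antimono (dip H v)"
  by (auto simp: antimono_def dip_def)

lemma dip_nonneg: "H \<ge> 0 \<Longrightarrow> 0 \<le> dip H v r"
  by (simp add: dip_def)

lemma dip_le_sqrt: "H \<ge> 0 \<Longrightarrow> dip H v r \<le> sqrt H"
  by (auto simp: dip_def pos_divide_le_eq mult_le_cancel_left1)

lemma range_dip_subset: "range (dip H v) \<subseteq> {sqrt (H / 2 ^ v), 0}"
  by (auto simp: dip_def)

lemma finite_range_dip: "finite (range (dip H v))"
  by (rule finite_subset[OF range_dip_subset]) simp

lemma card_range_dip_le: "card (range (dip H v)) \<le> 2"
  by (rule order_trans[OF card_mono[OF _ range_dip_subset]]) (auto intro: card_insert_le_m1)

lemma sum_dip_square: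
  assumes "H \<ge> 0" "2 ^ v \<le> m"
  shows "(\<Sum>r<m. (dip H v r)\<^sup>2) = H"
proof -
  have "(\<Sum>r<m. (dip H v r)\<^sup>2) = (\<Sum>r<2 ^ v :: nat. H / 2 ^ v)"
    using assms by (intro sum.mono_neutral_cong_right) (auto simp: dip_def)
  thus ?thesis by simp
qed

text \<open>At least half of the coordinates on which the longer dip lives lie beyond the end of the shorter one.\<close>

lemma sum_dip_dist_ge:
  assumes "H \<ge> 0" and "u \<noteq> v" "2 ^ u \<le> m" "2 ^ v \<le> m"
  shows "H / 2 \<le> (\<Sum>r<m. (dip H u r - dip H v r)\<^sup>2)"
  using assms(2-)
proof (induction u v rule: linorder_wlog)
  case (le u v)
  hence "(2::nat) ^ Suc u \<le> 2 ^ v" by (intro power_increasing) auto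
  hence "2 ^ v \<le> 2 * (2 ^ v - 2 ^ u :: nat)" by simp
  hence "(2 ^ v :: real) \<le> 2 * real (2 ^ v - 2 ^ u)"
    by (metis of_nat_le_iff of_nat_mult of_nat_numeral of_nat_power)
  hence "H / 2 \<le> real (2 ^ v - 2 ^ u) * (H / 2 ^ v)"
    using mult_right_mono[of "2 ^ v" "2 * real (2 ^ v - 2 ^ u)" "H / 2 ^ v / 2"] \<open>H \<ge> 0\<close> by simp
  also have "\<dots> = (\<Sum>r\<in>{2 ^ u..<2 ^ v}. (dip H u r - dip H v r)\<^sup>2)"
    using \<open>H \<ge> 0\<close> by (simp add: dip_def)
  also have "\<dots> \<le> (\<Sum>r<m. (dip H u r - dip H v r)\<^sup>2)"
    using le by (intro sum_mono2) auto
  finally show ?case .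
next
  case (sym u v)
  thus ?case by (simp add: power2_commute)
qed

lemma staircase_dip_in_Theta_up:
  assumes "H \<ge> 0" "K > 0" "2 * K \<le> k" "n > 0"
  shows "staircase n m K (sqrt H) (dip H \<circ> l) \<in> Theta_up n k"
proof (rule mono_on_in_Theta_up)
  show "mono_on {..<n} (staircase n m K (sqrt H) (dip H \<circ> l))"
    using \<open>H \<ge> 0\<close> by (intro mono_on_staircase) (simp_all add: antimono_dip dip_nonneg dip_le_sqrt)
  have "card (staircase n m K (sqrt H) (dip H \<circ> l) ` {..<n}) \<le> 2 * K"
    using \<open>K > 0\<close>
    by (intro card_staircase_image_le) (simp_all add: finite_range_dip card_range_dip_le)
  thus "card (staircase n m K (sqrt H) (dip H \<circ> l) ` {..<n}) \<le> k" using assms(3) by simp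
qed (simp_all add: assms(4) staircase_def)

section \<open>Minimax lower bounds\<close>

context gaussian_estimation
begin

lemma SUP_risk_ge_staircase:
  assumes K: "K > 0" "2 * K \<le> k" "K * m \<le> n" and M: "M \<ge> 2" "2 ^ (M - 1) \<le> m"
  shows "of_nat K * ennreal (\<sigma>\<^sup>2 * ln M / 128) \<le> (SUP \<theta>\<in>Theta_up n k. risk n \<sigma> est \<theta>)"
proof -
  define H where "H = \<sigma>\<^sup>2 * ln M / 2"
  have H: "H \<ge> 0" using M(1) by (simp add: H_def)
  have pow_le: "2 ^ v \<le> m" if "v < M" for v
    using that by (intro order_trans[OF power_increasing M(2)]) auto
  have "m > 0" using pow_le[of 0] M(1) by simp
  hence n: "n > 0" using K(1,3) by (metis less_le_trans nat_0_less_mult_iff)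
  let ?stair = "staircase n m K (sqrt H)"
  have "of_nat (card {..<K}) * ennreal (H / 2 / 32) \<le> (SUP \<theta>\<in>Theta_up n k. risk n \<sigma> est \<theta>)"
  proof (rule SUP_risk_ge_hypercube[where I = "\<lambda>j. {j * m..<j * m + m}" and V = "{..<M}"
        and \<theta> = "\<lambda>l. ?stair (dip H \<circ> l)" and \<eta> = "\<lambda>j g. ?stair ((dip H \<circ> g)(j := \<lambda>_. 0))"])
    show "?stair (dip H \<circ> l) \<in> Theta_up n k" for l
      by (rule staircase_dip_in_Theta_up[OF H K(1,2) n])
    fix j v g assume j: "j \<in> {..<K}" and v: "v \<in> {..<M}"
    hence "dip H v r = 0" if "m \<le> r" for r
      using pow_le[of v] that by (simp add: dip_def)
    hence "(\<Sum>i<n. (?stair (dip H \<circ> g(j := v)) i - ?stair ((dip H \<circ> g)(j := \<lambda>_. 0)) i)\<^sup>2) = H"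
      using j v K(3) H pow_le
      by (simp add: fun_upd_comp sum_staircase_upd_dist sum_dip_square)
    thus "(\<Sum>i<n. (?stair (dip H \<circ> g(j := v)) i - ?stair ((dip H \<circ> g)(j := \<lambda>_. 0)) i)\<^sup>2)
        \<le> \<sigma>\<^sup>2 * ln (card {..<M}) / 2"
      by (simp add: H_def)
    fix u assume "u \<in> {..<M}" and "u \<noteq> v"
    hence "H / 2 \<le> (\<Sum>r<m. (dip H u r - dip H v r)\<^sup>2)"
      using v by (intro sum_dip_dist_ge H pow_le) auto
    thus "H / 2 \<le> (\<Sum>i\<in>{j * m..<j * m + m}.
        (?stair (dip H \<circ> g(j := u)) i - ?stair (dip H \<circ> g(j := v)) i)\<^sup>2)"
      using j K(3) by (simp add: fun_upd_comp sum_block_staircase_upd_dist)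
  qed (use H M(1) K(3) in \<open>auto intro: disjoint_family_blocks dest: block_end_le\<close>)
  thus ?thesis by (simp add: H_def)
qed

lemma SUP_risk_ge_constant:
  assumes "k \<ge> 1" "n > 0"
  shows "ennreal (\<sigma>\<^sup>2 * ln 2 / 64) \<le> (SUP \<theta>\<in>Theta_up n k. risk n \<sigma> est \<theta>)"
proof -
  define H where "H = \<sigma>\<^sup>2 * ln 2 / 2"
  define \<theta> where "\<theta> l = (\<lambda>i\<in>{..<n}. if l () then sqrt (H / n) else 0)" for l :: "unit \<Rightarrow> bool"
  have H: "H \<ge> 0" by (simp add: H_def)
  have dist: "(\<Sum>i<n. (\<theta> l i - \<theta> l' i)\<^sup>2) = (if l () = l' () then 0 else H)" for l l'
    using H \<open>n > 0\<close> by (simp add: \<theta>_def)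
  have in_Theta: "\<theta> l \<in> Theta_up n k" for l
  proof (rule mono_on_in_Theta_up)
    have "\<theta> l ` {..<n} \<subseteq> {if l () then sqrt (H / n) else 0}" by (auto simp: \<theta>_def)
    from card_mono[OF _ this] show "card (\<theta> l ` {..<n}) \<le> k" using \<open>k \<ge> 1\<close> by simp
  qed (use \<open>n > 0\<close> in \<open>auto simp: \<theta>_def intro: mono_onI\<close>)
  have "of_nat (card (UNIV :: unit set)) * ennreal (H / 32) \<le> (SUP \<theta>\<in>Theta_up n k. risk n \<sigma> est \<theta>)"
    by (rule SUP_risk_ge_hypercube[where I = "\<lambda>_. {..<n}" and V = "UNIV :: bool set"
        and \<theta> = \<theta> and \<eta> = "\<lambda>_ _. \<theta> (\<lambda>_. False)"])
      (use H in_Theta in \<open>auto simp: dist disjoint_family_on_def H_def\<close>)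
  thus ?thesis by (simp add: H_def)
qed

end

lemma ln_ln_le_3_ln:
  fixes x :: real
  assumes "1 < x" "x \<le> 2 ^ (M + 3)" "M \<ge> 2"
  shows "ln (ln x) \<le> 3 * ln M"
proof -
  have "ln x \<le> ln (2 ^ (M + 3))" using assms(1,2) by simp
  also have "\<dots> = real (M + 3) * ln 2" by (rule ln_realpow)
  also have "\<dots> \<le> real (M + 3)" using ln_2_less_1 by (simp add: mult_le_cancel_left1)
  also have "M + 3 \<le> M ^ 3"
  proof -
    have "M + 3 \<le> 2 * 2 * M" using assms(3) by simp
    also have "\<dots> \<le> M * M * M" using assms(3) by (intro mult_le_mono) auto
    finally show ?thesis by (simp add: power3_eq_cube)
  qed
  finally have "ln x \<le> real M ^ 3" by simp
  hence "ln (ln x) \<le> ln (real M ^ 3)" using assms(1) by (intro ln_mono) auto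
  thus ?thesis by (simp add: ln_realpow)
qed

lemma floorlog_block_bounds:
  assumes "2 \<le> k" "k \<le> n"
  defines "K \<equiv> k div 2"
  defines "M \<equiv> floorlog 2 (n div K)"
  shows "2 \<le> M" "2 ^ (M - 1) \<le> n div K"
    "real k * ln (ln (16 * real n / real k)) \<le> 9 * (real K * ln M)"
proof -
  have K: "K > 0" "2 * K \<le> k" "k \<le> 3 * K" using assms(1) by (auto simp: K_def)
  have m: "2 \<le> n div K" using K assms(2) by (simp add: less_eq_div_iff_mult_less_eq)
  thus M: "2 \<le> M" unfolding M_def by (intro floorlog_geI) auto
  show "2 ^ (M - 1) \<le> n div K"
    using floorlog_bounds[of "n div K" 2] m by (simp add: M_def)
  have "n div K < 2 ^ M" using floorlog_bounds[of "n div K" 2] m by (simp add: M_def)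
  hence "n < 2 ^ M * K" using K(1) by (simp add: div_less_iff_less_mult)
  hence "real n \<le> 2 ^ M * real K"
    by (metis less_imp_le of_nat_le_iff of_nat_mult of_nat_numeral of_nat_power)
  also have "\<dots> \<le> 2 ^ M * (real k / 2)" using K(2) by (intro mult_left_mono) auto
  finally have "16 * real n / real k \<le> 2 ^ (M + 3)"
    using assms(1) by (simp add: pos_divide_le_eq power_add mult.commute)
  moreover have "1 < 16 * real n / real k" using assms(1,2) by (simp add: pos_less_divide_eq)
  ultimately have "ln (ln (16 * real n / real k)) \<le> 3 * ln M" using M by (intro ln_ln_le_3_ln)
  hence "real k * ln (ln (16 * real n / real k)) \<le> real k * (3 * ln M)"
    by (intro mult_left_mono) auto
  also have "\<dots> \<le> (3 * real K) * (3 * ln M)"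
    using K(3) M by (intro mult_right_mono) auto
  finally show "real k * ln (ln (16 * real n / real k)) \<le> 9 * (real K * ln M)" by simp
qed

lemma (in gaussian_estimation) SUP_risk_ge_ln_ln:
  assumes "2 \<le> k" "k \<le> n"
  shows "ennreal (\<sigma>\<^sup>2 * real k * ln (ln (16 * real n / real k)) / 1152)
    \<le> (SUP \<theta>\<in>Theta_up n k. risk n \<sigma> est \<theta>)"
proof -
  define K where "K = k div 2"
  define M where "M = floorlog 2 (n div K)"
  note M = floorlog_block_bounds[OF assms, folded K_def, folded M_def]
  have "\<sigma>\<^sup>2 / 1152 * (real k * ln (ln (16 * real n / real k))) \<le> \<sigma>\<^sup>2 / 1152 * (9 * (real K * ln M))"
    using M(3) by (intro mult_left_mono) auto
  hence "ennreal (\<sigma>\<^sup>2 * real k * ln (ln (16 * real n / real k)) / 1152)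
      \<le> of_nat K * ennreal (\<sigma>\<^sup>2 * ln M / 128)"
    by (simp add: ennreal_of_nat_eq_real_of_nat ennreal_mult'[symmetric] mult_ac ennreal_leI)
  also have "\<dots> \<le> (SUP \<theta>\<in>Theta_up n k. risk n \<sigma> est \<theta>)"
    using assms(1) M(1,2) by (intro SUP_risk_ge_staircase) (auto simp: K_def)
  finally show ?thesis .
qed

theorem mainTheorem3:
  shows "\<exists>c>0. \<forall>(n::nat) (k::nat) (\<sigma>::real) (est :: (nat \<Rightarrow> real) \<Rightarrow> (nat \<Rightarrow> real)).
     1 \<le> k \<longrightarrow> k \<le> n \<longrightarrow> \<sigma> > 0 \<longrightarrow>
     (\<forall>i<n. (\<lambda>x. est x i) \<in> borel_measurable (PiM {..<n} (\<lambda>_. lborel))) \<longrightarrow>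
     (SUP \<theta>\<in>Theta_up n k. risk n \<sigma> est \<theta>) \<ge>
       ennreal (if k = 1 then c * \<sigma>\<^sup>2
                else c * \<sigma>\<^sup>2 * real k * ln (ln (16 * real n / real k)))"
proof (intro exI[of _ "1 / 1152"] conjI allI impI)
  fix n k :: nat and \<sigma> :: real and est :: "(nat \<Rightarrow> real) \<Rightarrow> nat \<Rightarrow> real"
  assume k: "1 \<le> k" "k \<le> n" and "\<sigma> > 0"
    and "\<forall>i<n. (\<lambda>x. est x i) \<in> borel_measurable (PiM {..<n} (\<lambda>_. lborel))"
  then interpret gaussian_estimation n \<sigma> est by unfold_locales auto
  show "ennreal (if k = 1 then 1 / 1152 * \<sigma>\<^sup>2
      else 1 / 1152 * \<sigma>\<^sup>2 * real k * ln (ln (16 * real n / real k)))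
    \<le> (SUP \<theta>\<in>Theta_up n k. risk n \<sigma> est \<theta>)"
  proof (cases "k = 1")
    case True
    have "ennreal (1 / 1152 * \<sigma>\<^sup>2) \<le> ennreal (\<sigma>\<^sup>2 * ln 2 / 64)"
      using ln2_ge_two_thirds mult_left_mono[of "1 / 1152" "ln 2 / 64" "\<sigma>\<^sup>2"]
      by (intro ennreal_leI) simp
    also have "\<dots> \<le> (SUP \<theta>\<in>Theta_up n k. risk n \<sigma> est \<theta>)"
      using k by (intro SUP_risk_ge_constant) auto
    finally show ?thesis using True by simp
  next
    case False
    thus ?thesis using SUP_risk_ge_ln_ln[of k] k by simp
  qed
qed simp

end
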